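(* Let $M$ be a free $\mathbb{Z}$-module of finite rank, let $R\subset M$ be a finite set of nonzero elements, let $\Gamma$ be a finite group acting linearly on $M$ and mapping $R$ to itself, and let $g\in\Gamma$. Then the following procedure computes the poset $\mathscr P^g(R)$: (1) compute the $g$-orbits of $R$; (2) compute the set $\mathscr P^g(R)_{\mathrm{set}}$ of all distinct $\mathbb{Z}$-spans of unions of $g$-orbits in $R$; (3) determine the inclusion relations among the elements of $\mathscr P^g(R)_{\mathrm{set}}$. That is, $\mathscr P^g(R)$ equals, as a poset ordered by inclusion, the set of all submodules $\mathbb{Z}\langle U\rangle\subseteq M$ where $U\subseteq R$ is a union of $g$-orbits.
   Context: $\mathscr P(R)=\{\mathbb{Z}\langle S\rangle : S\subseteq R\}$ is the set of submodules of $M$ generated by subsets of $R$ (the empty subset generating $0$), ordered by inclusion. $\mathscr P^g(R)$ is the subposet of those $N\in\mathscr P(R)$ fixed by $g$ as submodules, i.e. $gN=N$. A $g$-orbit is an orbit of the cyclic group $\langle g\rangle$. *)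

theory Defs
  imports Complex_Main "HOL-Algebra.Group_Action" "HOL-Algebra.Generated_Groups"
begin

text \<open>
  A \<open>\<int>\<close>-module is a full type of class \<^class>\<open>ab_group_add\<close> together with an integer scaling
  satisfying the locale \<open>HOL.Modules.module\<close>.
\<close>

definition free_of_finite_rank :: "(int \<Rightarrow> 'm::ab_group_add \<Rightarrow> 'm) \<Rightarrow> bool"
  where "free_of_finite_rank scale \<longleftrightarrow>
    Modules.module scale \<and>
    (\<exists>B. finite B \<and> \<not> module.dependent scale B \<and> module.span scale B = UNIV)"

definition linear_group_action ::
    "('g, 'x) monoid_scheme \<Rightarrow> (int \<Rightarrow> 'm::ab_group_add \<Rightarrow> 'm) \<Rightarrow> ('g \<Rightarrow> 'm \<Rightarrow> 'm) \<Rightarrow> bool"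
  where "linear_group_action G scale \<phi> \<longleftrightarrow>
    group_action G UNIV \<phi> \<and> (\<forall>h\<in>carrier G. Modules.module_hom scale scale (\<phi> h))"

definition spans :: "(int \<Rightarrow> 'm::ab_group_add \<Rightarrow> 'm) \<Rightarrow> 'm set \<Rightarrow> 'm set set"
  where "spans scale R = {module.span scale S | S. S \<subseteq> R}"

definition fixed_spans ::
    "(int \<Rightarrow> 'm::ab_group_add \<Rightarrow> 'm) \<Rightarrow> ('g \<Rightarrow> 'm \<Rightarrow> 'm) \<Rightarrow> 'm set \<Rightarrow> 'g \<Rightarrow> 'm set set"
  where "fixed_spans scale \<phi> R g = {N \<in> spans scale R. \<phi> g ` N = N}"

text \<open>A poset is represented by its underlying set and its order relation on that set.\<close>

definition inclusion_poset :: "'a set set \<Rightarrow> 'a set set \<times> ('a set \<times> 'a set) set"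
  where "inclusion_poset \<N> = (\<N>, relation_of (\<subseteq>) \<N>)"

definition cyclic_orbits ::
    "('g, 'x) monoid_scheme \<Rightarrow> ('g \<Rightarrow> 'm \<Rightarrow> 'm) \<Rightarrow> 'm set \<Rightarrow> 'g \<Rightarrow> 'm set set"
  where "cyclic_orbits G \<phi> R g = orbits (G\<lparr>carrier := generate G {g}\<rparr>) R \<phi>"

definition fixed_spans_procedure ::
    "('g, 'x) monoid_scheme \<Rightarrow> (int \<Rightarrow> 'm::ab_group_add \<Rightarrow> 'm) \<Rightarrow> ('g \<Rightarrow> 'm \<Rightarrow> 'm) \<Rightarrow>
      'm set \<Rightarrow> 'g \<Rightarrow> 'm set set \<times> ('m set \<times> 'm set) set"
  where "fixed_spans_procedure G scale \<phi> R g =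
    (let Orb = cyclic_orbits G \<phi> R g;
         P_set = (\<lambda>T. module.span scale (\<Union>T)) ` Pow Orb;
         incl = {(N, N') \<in> P_set \<times> P_set. N \<subseteq> N'}
     in (P_set, incl))"

end

theory Submission
  imports Defs
begin

text \<open>
  A span of a union \<open>U\<close> of \<open>g\<close>-orbits is fixed because \<open>g\<close> permutes \<open>U\<close> and a linear map commutes
  with taking spans (\<open>image_Union_cyclic_orbits\<close>). The converse rests on replacing a generating set by the largest one: if
  \<open>N = \<int>\<langle>S\<rangle>\<close> is fixed by \<open>g\<close>, the given \<open>S \<subseteq> R\<close> need not be stable under \<open>g\<close>, but \<open>N \<inter> R\<close> is,
  since both \<open>N\<close> and \<open>R\<close> are stable, and it lies between \<open>S\<close> and \<open>N\<close>, so it still spans \<open>N\<close>.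
  Stability under \<open>g\<close> passes to all of \<open>\<langle>g\<rangle>\<close> because the setwise stabiliser of \<open>N\<close> is a subgroup,
  and a \<open>\<langle>g\<rangle>\<close>-stable subset of \<open>R\<close> is the union of the orbits of its elements
  (\<open>fixed_inter_eq_Union_cyclic_orbits\<close>).
\<close>

lemma (in group_action) one_act: "x \<in> E \<Longrightarrow> \<phi> \<one> x = x"
  by (metis id_eq_one restrict_apply')

lemma (in group_action) setwise_stabilizer_subgroup:
  assumes "N \<subseteq> E"
  shows "subgroup {h \<in> carrier G. \<phi> h ` N = N} G"
proof -
  interpret group G using group_hom group_hom.axioms(1) by blast
  have mult: "\<phi> (h \<otimes> k) ` N = \<phi> h ` \<phi> k ` N" if "h \<in> carrier G" "k \<in> carrier G" for h k
    unfolding image_image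
    by (rule image_cong[OF refl]) (use assms that in \<open>auto intro: composition_rule\<close>)
  have one: "\<phi> \<one> ` N = N"
    using one_act assms by (simp add: subset_iff)
  show ?thesis
  proof (rule subgroupI)
    fix h assume "h \<in> {h \<in> carrier G. \<phi> h ` N = N}"
    then have h: "h \<in> carrier G" "\<phi> h ` N = N" by auto
    then have "\<phi> (inv h) ` N = N" using mult[of "inv h" h] one by simp
    then show "inv h \<in> {h \<in> carrier G. \<phi> h ` N = N}" using h by simp
  qed (use one mult in auto)
qed

lemma (in group_action) generate_singleton_stabilizes:
  assumes "N \<subseteq> E" "g \<in> carrier G" "\<phi> g ` N = N" "h \<in> generate G {g}"
  shows "\<phi> h ` N = N"
proof -
  interpret group G using group_hom group_hom.axioms(1) by blast
  have "generate G {g} \<subseteq> {h \<in> carrier G. \<phi> h ` N = N}"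
    by (rule generate_subgroup_incl[OF _ setwise_stabilizer_subgroup]) (use assms in auto)
  then show ?thesis using assms by auto
qed

lemma cyclic_orbits_alt:
  "cyclic_orbits G \<phi> R g = (\<lambda>x. (\<lambda>h. \<phi> h x) ` generate G {g}) ` R"
  by (auto simp: cyclic_orbits_def orbits_def orbit_def)

lemma (in group) Union_cyclic_orbits_subset:
  assumes "g \<in> carrier G" "\<And>h. h \<in> carrier G \<Longrightarrow> \<phi> h ` R \<subseteq> R"
    and "T \<subseteq> cyclic_orbits G \<phi> R g"
  shows "\<Union>T \<subseteq> R"
proof -
  have "h \<in> carrier G" if "h \<in> generate G {g}" for h
    using generate_in_carrier[OF _ that] assms(1) by blast
  then have "X \<subseteq> R" if "X \<in> cyclic_orbits G \<phi> R g" for X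
    using that assms(2) unfolding cyclic_orbits_alt by blast
  then show ?thesis using assms(3) by blast
qed

text \<open>Each orbit is already fixed, since \<open>g\<langle>g\<rangle> = \<langle>g\<rangle>\<close> as a left coset.\<close>
lemma (in group_action) image_Union_cyclic_orbits:
  assumes "g \<in> carrier G" "R \<subseteq> E" "T \<subseteq> cyclic_orbits G \<phi> R g"
  shows "\<phi> g ` \<Union>T = \<Union>T"
proof -
  interpret group G using group_hom group_hom.axioms(1) by blast
  let ?H = "generate G {g}"
  have sub: "subgroup ?H G" using assms(1) by (intro generate_is_subgroup) auto
  have gH: "g \<in> ?H" by (rule generate.incl) simp
  have orb: "\<phi> g ` (\<lambda>h. \<phi> h x) ` ?H = (\<lambda>h. \<phi> h x) ` ?H" if "x \<in> E" for x
  proof -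
    have "\<phi> g ` (\<lambda>h. \<phi> h x) ` ?H = (\<lambda>h. \<phi> h x) ` (\<lambda>h. g \<otimes> h) ` ?H"
      unfolding image_image
      by (rule image_cong[OF refl])
        (use assms(1) that subgroup.mem_carrier[OF sub] composition_rule in auto)
    also have "(\<lambda>h. g \<otimes> h) ` ?H = g <# ?H" by (auto simp: l_coset_def)
    also have "g <# ?H = ?H" by (rule coset_join3[OF assms(1) sub gH])
    finally show ?thesis .
  qed
  have "\<phi> g ` X = X" if X: "X \<in> T" for X
  proof -
    obtain x where "x \<in> R" "X = (\<lambda>h. \<phi> h x) ` ?H"
      using X assms(3) unfolding cyclic_orbits_alt by blast
    then show ?thesis using orb[of x] assms(2) by blast
  qed
  then show ?thesis by (simp add: image_Union)
qed

text \<open>The orbits to choose are those of the elements of \<open>N \<inter> R\<close>: they cover it, and they stay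
  inside it because \<open>\<langle>g\<rangle>\<close> preserves both \<open>N\<close> and \<open>R\<close>.\<close>
lemma (in group_action) fixed_inter_eq_Union_cyclic_orbits:
  assumes "g \<in> carrier G" "N \<subseteq> E" "\<phi> g ` N = N"
    and R: "\<And>h. h \<in> carrier G \<Longrightarrow> \<phi> h ` R \<subseteq> R"
  shows "\<exists>T \<subseteq> cyclic_orbits G \<phi> R g. N \<inter> R = \<Union>T"
proof (intro exI conjI)
  interpret group G using group_hom group_hom.axioms(1) by blast
  let ?O = "\<lambda>x. (\<lambda>h. \<phi> h x) ` generate G {g}"
  let ?T = "?O ` (N \<inter> R)"
  show "?T \<subseteq> cyclic_orbits G \<phi> R g" by (auto simp: cyclic_orbits_alt)
  have "x \<in> ?O x" if "x \<in> N" for x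
  proof -
    have "\<phi> \<one> x = x" using that assms(2) one_act by blast
    then show ?thesis by (metis generate.one image_eqI)
  qed
  moreover have "\<phi> h x \<in> N \<inter> R" if "x \<in> N \<inter> R" "h \<in> generate G {g}" for x h
    using that R generate_in_carrier[of "{g}" h] assms(1)
      generate_singleton_stabilizes[OF assms(2,1,3)] by blast
  ultimately show "N \<inter> R = \<Union>?T" by blast
qed

lemma mem_fixed_spans_iff:
  assumes act: "linear_group_action G scale \<phi>" and g: "g \<in> carrier G"
    and R: "\<And>h. h \<in> carrier G \<Longrightarrow> \<phi> h ` R \<subseteq> R"
  shows "N \<in> fixed_spans scale \<phi> R g \<longleftrightarrow>
    (\<exists>T \<subseteq> cyclic_orbits G \<phi> R g. N = module.span scale (\<Union>T))"
proof -
  interpret group_action G UNIV \<phi> using act by (simp add: linear_group_action_def)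
  interpret lin: module_hom scale scale "\<phi> g" using act g by (simp add: linear_group_action_def)
  interpret group G using group_hom group_hom.axioms(1) by blast
  show ?thesis
  proof
    assume "N \<in> fixed_spans scale \<phi> R g"
    then obtain S where S: "S \<subseteq> R" "N = lin.m1.span S" and fixed: "\<phi> g ` N = N"
      by (auto simp: fixed_spans_def spans_def)
    have "S \<subseteq> N \<inter> R" using S lin.m1.span_superset by auto
    then have "lin.m1.span (N \<inter> R) = N"
      by (metis S(2) Int_lower1 lin.m1.span_mono lin.m1.span_span subset_antisym)
    then show "\<exists>T \<subseteq> cyclic_orbits G \<phi> R g. N = lin.m1.span (\<Union>T)"
      using fixed_inter_eq_Union_cyclic_orbits[OF g subset_UNIV fixed R] by metis
  next
    assume "\<exists>T \<subseteq> cyclic_orbits G \<phi> R g. N = lin.m1.span (\<Union>T)"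
    then obtain T where T: "T \<subseteq> cyclic_orbits G \<phi> R g" "N = lin.m1.span (\<Union>T)" by blast
    have "\<Union>T \<subseteq> R"
      by (rule Union_cyclic_orbits_subset[OF g R T(1)])
    moreover have "\<phi> g ` N = N"
      using image_Union_cyclic_orbits[OF g subset_UNIV T(1)] T(2) lin.span_image by metis
    ultimately show "N \<in> fixed_spans scale \<phi> R g"
      using T(2) by (auto simp: fixed_spans_def spans_def)
  qed
qed

theorem mainTheorem2:
  fixes scale :: "int \<Rightarrow> 'm::ab_group_add \<Rightarrow> 'm"
    and R :: "'m set"
    and \<Gamma> :: "('g, 'x) monoid_scheme"
    and \<phi> :: "'g \<Rightarrow> 'm \<Rightarrow> 'm"
    and g :: 'g
  assumes "free_of_finite_rank scale"
    and "finite R" and "0 \<notin> R"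
    and "group \<Gamma>" and "finite (carrier \<Gamma>)"
    and "linear_group_action \<Gamma> scale \<phi>"
    and "\<And>h. h \<in> carrier \<Gamma> \<Longrightarrow> \<phi> h ` R \<subseteq> R"
    and "g \<in> carrier \<Gamma>"
  shows "inclusion_poset (fixed_spans scale \<phi> R g) = fixed_spans_procedure \<Gamma> scale \<phi> R g
    \<and> inclusion_poset (fixed_spans scale \<phi> R g) =
        inclusion_poset {module.span scale U | U.
          U \<subseteq> R \<and> (\<exists>T \<subseteq> cyclic_orbits \<Gamma> \<phi> R g. U = \<Union>T)}"
proof -
  let ?orb = "cyclic_orbits \<Gamma> \<phi> R g"
  have mem: "N \<in> fixed_spans scale \<phi> R g \<longleftrightarrow> (\<exists>T \<subseteq> ?orb. N = module.span scale (\<Union>T))" for N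
    by (rule mem_fixed_spans_iff[OF assms(6,8,7)])
  have eq: "fixed_spans scale \<phi> R g = (\<lambda>T. module.span scale (\<Union>T)) ` Pow ?orb"
    by (rule Set.set_eqI) (simp only: mem image_iff Bex_def Pow_iff)
  have sub: "\<Union>T \<subseteq> R" if "T \<subseteq> ?orb" for T
    by (rule group.Union_cyclic_orbits_subset[OF assms(4,8,7) that])
  have "fixed_spans scale \<phi> R g =
      {module.span scale U | U. U \<subseteq> R \<and> (\<exists>T \<subseteq> ?orb. U = \<Union>T)}"
    by (rule Set.set_eqI, unfold mem mem_Collect_eq) (use sub in metis)
  moreover have "inclusion_poset (fixed_spans scale \<phi> R g) = fixed_spans_procedure \<Gamma> scale \<phi> R g"
    unfolding inclusion_poset_def fixed_spans_procedure_def Let_def relation_of_def eq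
    by (rule refl)
  ultimately show ?thesis by simp
qed

end
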